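(* Let $d\geq 3$ be an integer and let $q\geq 2$ be real. Let $w_c=w_c(q)=\frac{q-2}{(q-1)^{1-2/d}-1}-1$ if $q>2$ and $w_c(2)=\frac{2}{d-2}$. For $w>w_c$ we have $\Phi_{d,q,w}>q\left(1+\frac{w}{q}\right)^{d/2}$. Furthermore, if $q>2$, then the function $w\mapsto\frac{\partial}{\partial w}\Phi_{d,q,w}$ has a discontinuity at $w=w_c$.
   Context: For $w\ge 0$, $\Phi_{d,q,w}=\max_{t\in[-\pi,\pi]}\Phi_{d,q,w}(t)$, where $$\Phi_{d,q,w}(t)=\left(\sqrt{1+\frac{w}{q}}\cos(t)+\sqrt{\frac{(q-1)w}{q}}\sin(t)\right)^{d}+(q-1)\left(\sqrt{1+\frac{w}{q}}\cos(t)-\sqrt{\frac{w}{q(q-1)}}\sin(t)\right)^{d}.$$ The discontinuity of $\frac{\partial}{\partial w}\Phi_{d,q,w}$ at $w_c$ (first order phase transition) is understood in the sense that the left and right derivatives of $w\mapsto\Phi_{d,q,w}$ at $w_c$ are different. *)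

theory Defs
  imports "HOL-Analysis.Analysis"
begin

definition Phi_at :: "nat \<Rightarrow> real \<Rightarrow> real \<Rightarrow> real \<Rightarrow> real" where
  "Phi_at d q w t =
     (sqrt (1 + w / q) * cos t + sqrt ((q - 1) * w / q) * sin t) ^ d
     + (q - 1) * (sqrt (1 + w / q) * cos t - sqrt (w / (q * (q - 1))) * sin t) ^ d"

text \<open>The maximum over \<open>[-\<pi>, \<pi>]\<close> is written as a supremum; it is attained, see
  \<open>Phi_attained\<close> below. Only \<open>w \<ge> 0\<close> is meaningful.\<close>

definition Phi :: "nat \<Rightarrow> real \<Rightarrow> real \<Rightarrow> real" where
  "Phi d q w = (SUP t\<in>{-pi..pi}. Phi_at d q w t)"

definition w_crit :: "nat \<Rightarrow> real \<Rightarrow> real" where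
  "w_crit d q =
     (if q = 2 then 2 / (real d - 2)
      else (q - 2) / ((q - 1) powr (1 - 2 / real d) - 1) - 1)"

text \<open>Discontinuity of the derivative at \<open>x\<close> in the sense of first order phase transitions:
  both one-sided derivatives exist and they differ.\<close>

definition derivative_jump :: "(real \<Rightarrow> real) \<Rightarrow> real \<Rightarrow> bool" where
  "derivative_jump f x \<longleftrightarrow>
     (\<exists>l r. (f has_real_derivative l) (at_left x) \<and>
            (f has_real_derivative r) (at_right x) \<and> l \<noteq> r)"

lemma Phi_attained:
  "\<exists>t\<in>{-pi..pi}. Phi d q w = Phi_at d q w t \<and> (\<forall>s\<in>{-pi..pi}. Phi_at d q w s \<le> Phi_at d q w t)"
proof -
  have "continuous_on {-pi..pi} (Phi_at d q w)"
    unfolding Phi_at_def by (intro continuous_intros)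
  then obtain t where t: "t \<in> {-pi..pi}" "\<forall>s\<in>{-pi..pi}. Phi_at d q w s \<le> Phi_at d q w t"
    using continuous_attains_sup[of "{-pi..pi}" "Phi_at d q w"] by auto
  then have "Phi d q w = Phi_at d q w t"
    unfolding Phi_def by (intro cSup_eq_maximum) auto
  with t show ?thesis by blast
qed

end

theory Submission
  imports Defs
begin

text \<open>
  For \<open>w > 0\<close> the point \<open>(x, y)\<close> formed by the two bases in \<open>Phi_at d q w t\<close> runs through the
  ellipse \<open>quad q w x y = 1\<close>. By homogeneity \<open>Phi d q w\<close> is therefore the maximum of
  \<open>(x ^ d + (q - 1) * y ^ d) / quad q w x y powr (d / 2)\<close> over all nonzero \<open>(x, y)\<close>, where \<open>t = 0\<close>
  corresponds to the direction \<open>(1, 1)\<close>.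

  Put \<open>c = (q - 1) powr (1 / d)\<close> and \<open>Y = c * y\<close>. The numerator \<open>x ^ d + Y ^ d\<close> is symmetric in \<open>x\<close> and
  \<open>Y\<close>, and \<open>w_crit d q\<close> is exactly the value of \<open>w\<close> at which \<open>quad\<close> is symmetric as well. So at \<open>w_crit\<close>
  the mirror image \<open>(c ^ 2, 1)\<close> of \<open>(1, 1)\<close> attains the same value, and for larger \<open>w\<close> it does strictly
  better. For \<open>q = 2\<close> the two directions coincide, and instead \<open>(1, 1)\<close> stops being a local maximum.

  For the jump, Danskin's theorem identifies the left and right derivatives of \<open>Phi\<close> as the minimum and the
  maximum of the \<open>w\<close>-derivative over the maximisers. At \<open>w_crit\<close> the maximisers are closed under the
  reflection; a maximiser and its mirror image have different \<open>w\<close>-derivatives unless \<open>x ^ 2 = Y ^ 2\<close>,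
  and such points are no maximisers by a second order expansion. In particular it is not necessary to
  determine the maximisers.
\<close>

section \<open>Maximisation over an ellipse\<close>

text \<open>The two summands are \<open>(cos t)^2\<close> and \<open>(sin t)^2\<close>, recovered
  from the two bases \<open>x\<close> and \<open>y\<close> in \<open>Phi_at\<close>.\<close>

definition quad :: "real \<Rightarrow> real \<Rightarrow> real \<Rightarrow> real \<Rightarrow> real" where
  "quad q w x y = (x + (q - 1) * y)^2 / (q * (q + w)) + (q - 1) * (x - y)^2 / (q * w)"

definition ratio :: "nat \<Rightarrow> real \<Rightarrow> real \<Rightarrow> real \<Rightarrow> real \<Rightarrow> real" where
  "ratio d q w x y = (x ^ d + (q - 1) * y ^ d) * quad q w x y powr (- (real d / 2))"

lemma quad_pos:
  assumes "q > 1" "w > 0" "x \<noteq> 0 \<or> y \<noteq> 0"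
  shows "quad q w x y > 0"
proof (cases "x = y")
  case True
  then have "x + (q - 1) * y = q * y" by (simp add: algebra_simps)
  with True assms show ?thesis by (simp add: quad_def)
next
  case False
  have "(x + (q - 1) * y)^2 / (q * (q + w)) \<ge> 0" "(q - 1) * (x - y)^2 / (q * w) > 0"
    using assms False by auto
  then show ?thesis unfolding quad_def by linarith
qed

lemma quad_expand:
  assumes "q > 1" "w > 0"
  shows "quad q w x y
    = ((w + (q - 1)) * x^2 - 2 * (q - 1) * (x * y) + (q - 1) * (1 + w) * y^2) / (w * (q + w))"
proof -
  have "q > 0" "q + w > 0" using assms by auto
  then have "quad q w x y
    = (w * (x + (q - 1) * y)^2 + (q + w) * ((q - 1) * (x - y)^2)) / (q * (w * (q + w)))"
    unfolding quad_def using assms(2) by (simp add: divide_simps)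
  also have "w * (x + (q - 1) * y)^2 + (q + w) * ((q - 1) * (x - y)^2)
    = q * ((w + (q - 1)) * x^2 - 2 * (q - 1) * (x * y) + (q - 1) * (1 + w) * y^2)"
    by algebra
  finally show ?thesis using \<open>q > 0\<close> by simp
qed

lemma quad_scale: "quad q w (s * x) (s * y) = s^2 * quad q w x y"
proof -
  have *: "s * x + (q - 1) * (s * y) = s * (x + (q - 1) * y)" "s * x - s * y = s * (x - y)"
    by (simp_all add: algebra_simps)
  show ?thesis
    unfolding quad_def * power_mult_distrib distrib_left[of "s^2"]
      times_divide_eq_right mult.left_commute[of "s^2"] ..
qed

lemma powr_half_power:
  fixes x :: real
  assumes "d > 0" "x \<ge> 0"
  shows "(x^2) powr (real d / 2) = x ^ d"
proof (cases "x = 0")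
  case False
  then have "x > 0" using assms by simp
  then have "(x^2) powr (real d / 2) = x powr (2 * (real d / 2))"
    by (simp only: powr_powr flip: powr_numeral)
  then show ?thesis using \<open>x > 0\<close> by (simp add: powr_realpow)
qed (use assms in simp)

text \<open>The numerator has degree \<open>d\<close> and the power of \<open>quad\<close> has
  degree \<open>-d\<close>. A negative factor would change the sign for odd
  \<open>d\<close>.\<close>

lemma ratio_scale:
  assumes "s > 0" "d > 0"
  shows "ratio d q w (s * x) (s * y) = ratio d q w x y"
proof (cases "quad q w x y = 0")
  case False
  have "(s^2) powr (- (real d / 2)) = inverse (s ^ d)"
    using powr_half_power[of d s] assms by (simp add: powr_minus)
  then have "quad q w (s * x) (s * y) powr (- (real d / 2))
      = inverse (s ^ d) * quad q w x y powr (- (real d / 2))"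
    by (simp add: quad_scale powr_mult)
  moreover have "(s * x) ^ d + (q - 1) * (s * y) ^ d = s ^ d * (x ^ d + (q - 1) * y ^ d)"
    by (simp add: power_mult_distrib algebra_simps)
  ultimately show ?thesis
    using assms(1) by (simp add: ratio_def)
\<comment> \<open>Since \<open>0 powr a = 0\<close>, both sides vanish where \<open>quad\<close>
  does.\<close>
qed (simp add: ratio_def quad_scale)

lemma sqrt_weight_eq:
  assumes "q > 1" "w > 0"
  shows "sqrt ((q - 1) * w / q) = (q - 1) * sqrt (w / (q * (q - 1)))"
proof -
  have "(q - 1) * w / q = (q - 1)^2 * (w / (q * (q - 1)))"
    using assms by (simp add: power2_eq_square)
  then have "sqrt ((q - 1) * w / q) = \<bar>q - 1\<bar> * sqrt (w / (q * (q - 1)))"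
    by (simp only: real_sqrt_mult real_sqrt_abs)
  then show ?thesis using assms by simp
qed

lemma quad_Phi_at_coordinates:
  assumes "q > 1" "w > 0"
  shows "quad q w (sqrt (1 + w / q) * cos t + sqrt ((q - 1) * w / q) * sin t)
                  (sqrt (1 + w / q) * cos t - sqrt (w / (q * (q - 1))) * sin t) = 1"
proof -
  define b where "b = sqrt (w / (q * (q - 1)))"
  define a where "a = sqrt (1 + w / q)"
  have b: "sqrt ((q - 1) * w / q) = (q - 1) * b"
    unfolding b_def by (rule sqrt_weight_eq[OF assms(1,2)])
  have b2: "b^2 = w / (q * (q - 1))" and a2: "a^2 = 1 + w / q"
    using assms by (simp_all add: b_def a_def)
  have "a * cos t + (q - 1) * b * sin t + (q - 1) * (a * cos t - b * sin t) = q * a * cos t"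
       "a * cos t + (q - 1) * b * sin t - (a * cos t - b * sin t) = q * b * sin t"
    by (simp_all add: algebra_simps)
  then have "quad q w (a * cos t + (q - 1) * b * sin t) (a * cos t - b * sin t)
      = (q^2 * a^2 / (q * (q + w))) * (cos t)^2 + ((q - 1) * q^2 * b^2 / (q * w)) * (sin t)^2"
    unfolding quad_def by (simp add: power_mult_distrib)
  also have "q^2 * a^2 / (q * (q + w)) = 1"
    unfolding a2 using assms by (simp add: add_divide_eq_iff power2_eq_square)
  also have "(q - 1) * q^2 * b^2 / (q * w) = 1"
    unfolding b2 using assms by (simp add: power2_eq_square)
  finally show ?thesis by (simp add: b a_def b_def)
qed

lemma Phi_at_coordinates_onto:
  assumes q: "q > 1" and w: "w > 0" and Q: "quad q w x y = 1"
  obtains t where "t \<in> {-pi..pi}"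
    "sqrt (1 + w / q) * cos t + sqrt ((q - 1) * w / q) * sin t = x"
    "sqrt (1 + w / q) * cos t - sqrt (w / (q * (q - 1))) * sin t = y"
proof -
  define b where "b = sqrt (w / (q * (q - 1)))"
  define a where "a = sqrt (1 + w / q)"
  have b: "sqrt ((q - 1) * w / q) = (q - 1) * b"
    unfolding b_def by (rule sqrt_weight_eq[OF q w])
  have b2: "b^2 = w / (q * (q - 1))" and a2: "a^2 = 1 + w / q"
    using assms by (simp_all add: b_def a_def)
  have pos: "a > 0" "b > 0" using q w by (simp_all add: a_def b_def add_pos_pos)
  \<comment> \<open>\<open>C\<close> and \<open>S\<close> solve the two linear coordinate equations
    for the cosine and the sine.\<close>
  define C where "C = (x + (q - 1) * y) / (q * a)"
  define S where "S = (x - y) / (q * b)"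
  have den: "(q * a)^2 = q * (q + w)" "(q * b)^2 = q * w / (q - 1)"
    unfolding power_mult_distrib a2 b2 using q w by (simp_all add: divide_simps power2_eq_square)
  have "C^2 + S^2 = (x + (q - 1) * y)^2 / (q * (q + w)) + (x - y)^2 / (q * w / (q - 1))"
    unfolding C_def S_def by (simp only: power_divide den)
  also have "\<dots> = 1"
    using Q q w by (simp add: quad_def mult.commute)
  finally have "C^2 + S^2 = 1" .
  then obtain t' where t': "C = cos t'" "S = sin t'" using sincos_total_2pi_le by blast
  \<comment> \<open>\<open>t'\<close> need not lie in \<open>{-pi..pi}\<close>; its principal value
    does.\<close>
  obtain t where t: "-pi < t" "t \<le> pi" "sin t = S" "cos t = C"
    using sincos_principal_value[of t'] t' by auto
  have *: "a * C = (x + (q - 1) * y) / q" "b * S = (x - y) / q"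
    using pos q by (simp_all add: C_def S_def)
  have "a * C + (q - 1) * (b * S) = x" "a * C - b * S = y"
    unfolding * using q by (simp_all add: field_simps)
  with t show ?thesis
    by (intro that[of t]) (simp_all add: b mult.assoc flip: a_def b_def)
qed

text \<open>Dividing \<open>(x, y)\<close> by the square root of \<open>quad\<close> leads to the
  ellipse, where the power of \<open>quad\<close> is 1 and \<open>ratio\<close> is a value of
  \<open>Phi_at\<close>. All lower bounds on \<open>Phi\<close> below come from test directions
  inserted here.\<close>

lemma ratio_le_Phi:
  assumes q: "q > 1" and w: "w > 0" and d: "d > 0" and xy: "x \<noteq> 0 \<or> y \<noteq> 0"
  shows "ratio d q w x y \<le> Phi d q w"
proof -
  define s where "s = 1 / sqrt (quad q w x y)"
  have pos: "quad q w x y > 0" using quad_pos[OF q w xy] .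
  then have s: "s > 0" "s^2 * quad q w x y = 1" by (simp_all add: s_def power_divide)
  then have Q: "quad q w (s * x) (s * y) = 1" by (simp add: quad_scale)
  obtain t where t: "t \<in> {-pi..pi}"
    "sqrt (1 + w / q) * cos t + sqrt ((q - 1) * w / q) * sin t = s * x"
    "sqrt (1 + w / q) * cos t - sqrt (w / (q * (q - 1))) * sin t = s * y"
    using Phi_at_coordinates_onto[OF q w Q] by blast
  have "ratio d q w x y = ratio d q w (s * x) (s * y)"
    by (rule ratio_scale[OF s(1) d, symmetric])
  also have "\<dots> = Phi_at d q w t"
    unfolding Phi_at_def t(2,3) ratio_def Q by simp
  also have "\<dots> \<le> Phi d q w" using Phi_attained[of d q w] t(1) by auto
  finally show ?thesis .
qed

lemma Phi_eq_ratio: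
  assumes q: "q > 1" and w: "w > 0"
  obtains x y where "x \<noteq> 0 \<or> y \<noteq> 0" "Phi d q w = ratio d q w x y"
proof -
  obtain t where t: "Phi d q w = Phi_at d q w t" using Phi_attained[of d q w] by blast
  define x where "x = sqrt (1 + w / q) * cos t + sqrt ((q - 1) * w / q) * sin t"
  define y where "y = sqrt (1 + w / q) * cos t - sqrt (w / (q * (q - 1))) * sin t"
  have Q: "quad q w x y = 1"
    unfolding x_def y_def by (rule quad_Phi_at_coordinates[OF q w])
  then have "x \<noteq> 0 \<or> y \<noteq> 0" by (auto simp: quad_def)
  moreover have "Phi d q w = ratio d q w x y"
    unfolding ratio_def Q t by (simp add: Phi_at_def x_def y_def)
  ultimately show ?thesis by (rule that)
qed

section \<open>Test directions and strict lower bounds above the critical parameter\<close>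

text \<open>These are the binomial expansions up to second order. They are proved together because
  the sum and the difference for \<open>n + 1\<close> each arise from the one for \<open>n\<close>
  by adding \<open>e\<close> times the other.\<close>

lemma two_point_power_bound:
  fixes e :: real
  assumes "0 \<le> e" "e \<le> 1"
  shows "(1 + e) ^ n + (1 - e) ^ n \<ge> 2 + real n * (real n - 1) * e^2"
    and "(1 + e) ^ n - (1 - e) ^ n \<ge> 2 * real n * e"
proof (induction n)
  case (Suc n)
  {
    case 1
    have "(1 + e) ^ Suc n + (1 - e) ^ Suc n
        = ((1 + e) ^ n + (1 - e) ^ n) + e * ((1 + e) ^ n - (1 - e) ^ n)"
      by (simp add: algebra_simps)
    moreover have "e * ((1 + e) ^ n - (1 - e) ^ n) \<ge> e * (2 * real n * e)"
      using Suc.IH(2) assms by (intro mult_left_mono) auto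
    moreover have "2 + real (Suc n) * (real (Suc n) - 1) * e^2
        = 2 + real n * (real n - 1) * e^2 + e * (2 * real n * e)"
      by (simp add: algebra_simps power2_eq_square)
    ultimately show ?case using Suc.IH(1) by linarith
  next
    case 2
    have "(1 + e) ^ Suc n - (1 - e) ^ Suc n
        = ((1 + e) ^ n - (1 - e) ^ n) + e * ((1 + e) ^ n + (1 - e) ^ n)"
      by (simp add: algebra_simps)
    moreover have "(1 + e) ^ n + (1 - e) ^ n \<ge> 2"
    proof -
      have "real n * (real n - 1) * e^2 \<ge> 0" by (cases n) auto
      with Suc.IH(1) show ?thesis by linarith
    qed
    then have "e * ((1 + e) ^ n + (1 - e) ^ n) \<ge> e * 2"
      using assms by (intro mult_left_mono) auto
    ultimately show ?case using Suc.IH(2) by (simp add: algebra_simps)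
  }
qed simp_all

text \<open>Near \<open>e = 0\<close> the left side is at least
  \<open>2 + d * (d - 1) * e^2\<close>, while the right side behaves like
  \<open>2 + d * k * e^2\<close>. Where \<open>quad\<close> is proportional to
  \<open>1 + k * e^2\<close> along such a perturbation, the symmetric point is therefore not a local
  maximum.\<close>

lemma two_point_power_gt:
  assumes "d > 0" "k < real d - 1"
  obtains e :: real where "0 < e" "e < 1"
    "(1 + e) ^ d + (1 - e) ^ d > 2 * (1 + k * e^2) powr (real d / 2)"
proof -
  \<comment> \<open>Half of the gap left by \<open>two_point_power_bound\<close>, as a function of
    \<open>z = e^2\<close>, so that the first derivative at 0 decides.\<close>
  define g where "g z = 1 + real d * (real d - 1) / 2 * z - (1 + k * z) powr (real d / 2)" for z
  have "(g has_real_derivative (real d / 2 * (real d - 1 - k))) (at 0)"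
    unfolding g_def by (rule derivative_eq_intros refl | simp add: field_simps)+
  then obtain h where h: "h > 0" "\<And>z. 0 < z \<Longrightarrow> z < h \<Longrightarrow> g 0 < g (0 + z)"
    using DERIV_pos_inc_right[of g _ 0] assms by (metis diff_gt_0_iff_gt half_gt_zero_iff mult_pos_pos of_nat_0_less_iff)
  define z where "z = min (h / 2) (1 / 4)"
  have z: "0 < z" "z < h" "z < 1" using h(1) by (auto simp: z_def)
  define e where "e = sqrt z"
  have e: "0 < e" "e < 1" "e^2 = z" using z by (auto simp: e_def)
  have "g z > 0" using h(2)[OF z(1,2)] by (simp add: g_def)
  then have "2 + real d * (real d - 1) * e^2 > 2 * (1 + k * e^2) powr (real d / 2)"
    by (simp add: g_def e(3))
  with two_point_power_bound(1)[of e d] e show ?thesis by (intro that[of e]) auto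
qed

lemma Phi_gt_q2:
  assumes d: "d \<ge> 3" and w: "w > 2 / (real d - 2)"
  shows "Phi d 2 w > 2 * (1 + w / 2) powr (real d / 2)"
proof -
  have "2 / (real d - 2) > 0" using d by simp
  with w have w0: "w > 0" by linarith
  \<comment> \<open>The ratio of the eigenvalues of \<open>quad 2 w\<close> on the antidiagonal and
    on the diagonal. The assumption on \<open>w\<close> says exactly that
    \<open>k < d - 1\<close>.\<close>
  define k where "k = (2 + w) / w"
  have "k < real d - 1" using w w0 d by (simp add: k_def field_simps)
  then obtain e where e: "0 < e" "e < 1"
    "(1 + e) ^ d + (1 - e) ^ d > 2 * (1 + k * e^2) powr (real d / 2)"
    using two_point_power_gt[of d k] d by auto
  have Q: "quad 2 w (1 + e) (1 - e) = (1 + k * e^2) / (1 + w / 2)"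
  proof -
    have "quad 2 w (1 + e) (1 - e) = (2 * w + 2 * (2 + w) * e^2) / (w * (2 + w))"
      using w0 by (simp add: quad_expand algebra_simps power2_eq_square)
    also have "\<dots> = (2 * w * (1 + k * e^2)) / (w * (2 + w))"
      using w0 by (simp add: k_def distrib_left)
    finally show ?thesis using w0 by (simp add: divide_simps)
  qed
  have kp: "1 + k * e^2 > 0" using w0 by (simp add: k_def add_pos_nonneg)
  have wp: "1 + w / 2 > 0" using w0 by simp
  have "2 * (1 + w / 2) powr (real d / 2)
      = 2 * (1 + k * e^2) powr (real d / 2) * quad 2 w (1 + e) (1 - e) powr (- (real d / 2))"
    unfolding Q powr_minus powr_divide inverse_divide using kp wp by simp
  also have "\<dots> < ratio d 2 w (1 + e) (1 - e)"
    unfolding ratio_def using e(3) quad_pos[of 2 w "1 + e" "1 - e"] w0 e(1)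
    by (intro mult_strict_right_mono) auto
  also have "\<dots> \<le> Phi d 2 w" using d w0 e by (intro ratio_le_Phi) auto
  finally show ?thesis .
qed

text \<open>Since \<open>(q - 1) powr (2 / d) = c^2\<close>, the critical value is rational in
  \<open>c^2\<close>. It is positive because \<open>1 < c^2 < c ^ d = q - 1\<close>, where
  \<open>d > 2\<close> enters.\<close>

lemma w_crit_eq:
  assumes "d \<ge> 3" "q > 2" and c: "c > 0" "c ^ d = q - 1"
  shows "c > 1" "c^2 < q - 1" "w_crit d q = (q - 1) * (c^2 - 1) / (q - 1 - c^2)" "w_crit d q > 0"
proof -
  show c1: "c > 1"
    using c assms(2) power_le_one[of c d] by (cases "c \<le> 1") auto
  have "c^2 < c ^ d" using c1 assms(1) by (intro power_strict_increasing) auto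
  then show lt: "c^2 < q - 1" by (simp add: c)
  have "(q - 1) powr (1 - 2 / real d) = (q - 1) / (q - 1) powr (2 / real d)"
    using assms by (simp add: powr_diff)
  also have "(q - 1) powr (2 / real d) = c^2"
    unfolding c(2)[symmetric] powr_realpow[OF c(1), symmetric] powr_powr using c(1) assms(1)
    by simp
  finally have "w_crit d q = (q - 2) / ((q - 1) / c^2 - 1) - 1"
    using assms by (simp add: w_crit_def)
  also have "\<dots> = (q - 1) * (c^2 - 1) / (q - 1 - c^2)"
    using lt c(1) by (simp add: field_simps)
  finally show *: "w_crit d q = (q - 1) * (c^2 - 1) / (q - 1 - c^2)" .
  show "w_crit d q > 0" unfolding * using c1 lt \<open>q > 2\<close> by simp
qed

lemma Phi_gt:
  assumes d: "d \<ge> 3" and q: "q > 2" and w: "w > w_crit d q"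
  shows "Phi d q w > q * (1 + w / q) powr (real d / 2)"
proof -
  define c where "c = (q - 1) powr (1 / real d)"
  have c: "c > 0" "c ^ d = q - 1"
    unfolding c_def using q d by (simp_all add: powr_power)
  note wc = w_crit_eq[OF d q c]
  define p where "p = c^2"
  have p: "p > 1" "p < q - 1" using wc(1,2) by (simp_all add: p_def)
  have pd: "p powr (real d / 2) = q - 1" "p ^ d = (q - 1)^2"
    using powr_half_power[of d c] c(1) d unfolding c(2)[symmetric]
    by (simp_all add: p_def mult.commute flip: power_mult)
  have w0: "w > 0" using wc(4) w by linarith
  define Q where "Q = quad q w p 1"
  have Q0: "Q > 0" unfolding Q_def using q w0 by (intro quad_pos) auto
  have wl: "w * (q - 1 - p) > (q - 1) * (p - 1)"
    using w p unfolding wc(3) p_def[symmetric] by (simp add: field_simps)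
  \<comment> \<open>The numerator at \<open>(p, 1)\<close> is \<open>q * (q - 1)\<close> and
    \<open>p powr (d / 2) = q - 1\<close>, so the claim reduces to
    \<open>Q * (1 + w / q) < p\<close>.\<close>
  have "Q * (1 + w / q) = ((w + (q - 1)) * p^2 - 2 * (q - 1) * p + (q - 1) * (1 + w)) / (q * w)"
    unfolding Q_def using w0 q by (simp add: quad_expand divide_simps)
  then have "p - Q * (1 + w / q)
    = (p * (q * w) - ((w + (q - 1)) * p^2 - 2 * (q - 1) * p + (q - 1) * (1 + w))) / (q * w)"
    using w0 q by (simp only: diff_divide_distrib) simp
  \<comment> \<open>The factor linear in \<open>w\<close> vanishes exactly at
    \<open>w_crit d q\<close>; \<open>wl\<close> gives its sign.\<close>
  also have "p * (q * w) - ((w + (q - 1)) * p^2 - 2 * (q - 1) * p + (q - 1) * (1 + w))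
    = (p - 1) * (w * (q - 1 - p) - (q - 1) * (p - 1))"
    by algebra
  finally have "p - Q * (1 + w / q) = (p - 1) * (w * (q - 1 - p) - (q - 1) * (p - 1)) / (q * w)" .
  moreover have "(p - 1) * (w * (q - 1 - p) - (q - 1) * (p - 1)) / (q * w) > 0"
    using wl p w0 q by simp
  ultimately have "Q * (1 + w / q) < p" by linarith
  then have "(Q * (1 + w / q)) powr (real d / 2) < p powr (real d / 2)"
    using Q0 w0 q d by (intro powr_less_mono2) auto
  then have "Q powr (real d / 2) * (1 + w / q) powr (real d / 2) < q - 1"
    using Q0 w0 q by (simp add: powr_mult pd)
  then have "(1 + w / q) powr (real d / 2) < (q - 1) * Q powr (- (real d / 2))"
    using Q0 by (simp add: powr_minus field_simps)
  then have "q * (1 + w / q) powr (real d / 2) < q * ((q - 1) * Q powr (- (real d / 2)))"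
    using q by simp
  also have "\<dots> = ratio d q w p 1"
  proof -
    have "p ^ d + (q - 1) * 1 ^ d = q * (q - 1)"
      unfolding pd(2) by (simp add: power2_eq_square algebra_simps)
    then show ?thesis by (simp only: ratio_def Q_def mult.assoc)
  qed
  also have "\<dots> \<le> Phi d q w" using d q w0 by (intro ratio_le_Phi) auto
  finally show ?thesis .
qed

section \<open>One-sided derivatives of maximum functions\<close>

lemma has_real_derivative_mirror_at_right:
  assumes "((\<lambda>w. f (- w)) has_real_derivative D) (at_right (- x))"
  shows "(f has_real_derivative (- D)) (at_left x)"
proof -
  have "((\<lambda>w. f (- w)) has_real_derivative D) (at (- x) within uminus ` {..<x})"
    using assms by (simp add: greaterThan_def)
  then have "(((\<lambda>w. f (- w)) \<circ> uminus) has_real_derivative (D * (-1))) (at x within {..<x})"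
    by (rule DERIV_image_chain) (auto intro!: derivative_eq_intros)
  then show ?thesis by (simp add: o_def)
qed

text \<open>Danskin's theorem. Maximisers at \<open>w\<close> accumulate, as \<open>w\<close> tends to \<open>x\<close>, at maximisers at \<open>x\<close>.\<close>

lemma max_function_right_derivative:
  fixes f f' :: "real \<Rightarrow> 'a::metric_space \<Rightarrow> real"
  assumes K: "compact K" and ab: "a < x" "x < b"
    and deriv: "\<And>w t. w \<in> {a<..<b} \<Longrightarrow> t \<in> K \<Longrightarrow> ((\<lambda>w. f w t) has_real_derivative f' w t) (at w)"
    and cont: "continuous_on ({a<..<b} \<times> K) (\<lambda>(w, t). f w t)"
    and cont': "continuous_on ({a<..<b} \<times> K) (\<lambda>(w, t). f' w t)"
    and le: "\<And>w t. w \<in> {a<..<b} \<Longrightarrow> t \<in> K \<Longrightarrow> f w t \<le> F w"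
    and attained: "\<And>w. w \<in> {a<..<b} \<Longrightarrow> \<exists>t\<in>K. F w = f w t"
  obtains D where "(F has_real_derivative D) (at_right x)"
    "\<And>t. t \<in> K \<Longrightarrow> f x t = F x \<Longrightarrow> f' x t \<le> D"
proof -
  have seq: "(\<lambda>n. f (w n) (t n)) \<longlonglongrightarrow> f x t0" "(\<lambda>n. f' (w n) (t n)) \<longlonglongrightarrow> f' x t0"
    if "w \<longlonglongrightarrow> x" "t \<longlonglongrightarrow> t0" "t0 \<in> K" "\<And>n. w n \<in> {a<..<b}" "\<And>n. t n \<in> K" for w t t0
  proof -
    have "(\<lambda>n. (w n, t n)) \<longlonglongrightarrow> (x, t0)" using that by (intro tendsto_Pair)
    then show "(\<lambda>n. f (w n) (t n)) \<longlonglongrightarrow> f x t0" "(\<lambda>n. f' (w n) (t n)) \<longlonglongrightarrow> f' x t0"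
      using continuous_on_tendsto_compose[OF cont, of "\<lambda>n. (w n, t n)" "(x, t0)" sequentially]
        continuous_on_tendsto_compose[OF cont', of "\<lambda>n. (w n, t n)" "(x, t0)" sequentially]
        that ab by auto
  qed
  define M where "M = {t \<in> K. f x t = F x}"
  have contx: "continuous_on K (f x)" "continuous_on K (f' x)"
    using continuous_on_compose2[OF cont continuous_on_Pair[OF continuous_on_const[of K x] continuous_on_id[of K]]]
      continuous_on_compose2[OF cont' continuous_on_Pair[OF continuous_on_const[of K x] continuous_on_id[of K]]] ab
    by (auto simp: image_subset_iff)
  have "closed M"
    unfolding M_def using contx(1) compact_imp_closed[OF K]
    by (rule continuous_closed_preimage_constant)
  then have "compact (K \<inter> M)" using K by (intro compact_Int_closed)
  also have "K \<inter> M = M" by (auto simp: M_def)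
  finally have "compact M" .
  moreover have "M \<noteq> {}" using attained[of x] ab by (fastforce simp: M_def)
  moreover have "continuous_on M (f' x)"
    using contx(2) by (rule continuous_on_subset) (auto simp: M_def)
  ultimately obtain t1 where t1: "t1 \<in> M" "\<And>t. t \<in> M \<Longrightarrow> f' x t \<le> f' x t1"
    using continuous_attains_sup by metis
  define D where "D = f' x t1"
  have t1K: "t1 \<in> K" "f x t1 = F x" using t1(1) by (auto simp: M_def)
  have near: "eventually (\<lambda>w. w \<in> {x<..<b}) (at_right x)"
    using ab by (simp add: eventually_at_right_field) (auto intro: exI[of _ b])
  have "((\<lambda>w. (F w - F x) / (w - x)) \<longlongrightarrow> D) (at_right x)"
  proof (rule order_tendstoI)
    \<comment> \<open>Lower bound: \<open>F\<close> dominates \<open>f\<close> at the fixed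
      maximiser \<open>t1\<close>, with equality at \<open>x\<close>.\<close>
    fix y assume "y < D"
    have "((\<lambda>w. (f w t1 - f x t1) / (w - x)) \<longlongrightarrow> D) (at_right x)"
      using DERIV_subset[OF deriv[of x t1], of "{x<..}"] ab t1K
      by (simp add: has_field_derivative_iff D_def)
    then have "eventually (\<lambda>w. y < (f w t1 - f x t1) / (w - x)) (at_right x)"
      using \<open>y < D\<close> by (rule order_tendstoD)
    with near show "eventually (\<lambda>w. y < (F w - F x) / (w - x)) (at_right x)"
    proof eventually_elim
      case (elim w)
      have "f w t1 \<le> F w" using le[of w t1] elim ab t1K by auto
      then have "(f w t1 - f x t1) / (w - x) \<le> (F w - F x) / (w - x)"
        using elim t1K by (intro divide_right_mono) auto
      with elim show ?case by linarith
    qed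
  next
    fix y assume "D < y"
    show "eventually (\<lambda>w. (F w - F x) / (w - x) < y) (at_right x)"
    proof (rule ccontr)
      assume "\<not> ?thesis"
      then have freq: "\<exists>w. x < w \<and> w < z \<and> (F w - F x) / (w - x) \<ge> y" if "z > x" for z
        using that unfolding eventually_at_right_field by (meson not_less)
      \<comment> \<open>Upper bound: for a maximiser \<open>t\<close> at \<open>w\<close>, the mean
        value theorem turns a difference quotient of at least \<open>y\<close> into a point
        \<open>u\<close> between \<open>x\<close> and \<open>w\<close> with
        \<open>f' u t \<ge> y\<close>.\<close>
      have "\<exists>w u t. w \<in> {x<..<b} \<and> u \<in> {x<..<b} \<and> w < x + inverse (Suc n) \<and> u < x + inverse (Suc n)
          \<and> t \<in> K \<and> F w = f w t \<and> f' u t \<ge> y" for n :: nat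
      proof -
        obtain w where w: "x < w" "w < min b (x + inverse (Suc n))" "(F w - F x) / (w - x) \<ge> y"
          using freq[of "min b (x + inverse (Suc n))"] ab by auto
        obtain t where t: "t \<in> K" "F w = f w t" using attained[of w] w ab by auto
        obtain u where u: "x < u" "u < w" "f w t - f x t = (w - x) * f' u t"
          using MVT2[of x w "\<lambda>w. f w t" "\<lambda>w. f' w t"] deriv t w ab by auto
        have "f x t \<le> F x" using le[of x t] t ab by auto
        then have "(w - x) * f' u t \<ge> F w - F x" using u(3) t(2) by simp
        then have "f' u t \<ge> (F w - F x) / (w - x)"
          using w(1) by (simp add: divide_le_eq mult.commute)
        with w t u show ?thesis by (intro exI[of _ w] exI[of _ u] exI[of _ t]) auto
      qed
      then obtain w u t where wut: "\<And>n. w n \<in> {x<..<b}" "\<And>n. u n \<in> {x<..<b}"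
          "\<And>n. w n < x + inverse (Suc n)" "\<And>n. u n < x + inverse (Suc n)"
          "\<And>n. t n \<in> K" "\<And>n. F (w n) = f (w n) (t n)" "\<And>n. f' (u n) (t n) \<ge> y"
        by metis
      have inv: "(\<lambda>n. x + inverse (real (Suc n))) \<longlonglongrightarrow> x"
        using tendsto_add[OF tendsto_const LIMSEQ_inverse_real_of_nat, of x] by simp
      have lim: "w \<longlonglongrightarrow> x" "u \<longlonglongrightarrow> x"
        by (rule real_tendsto_sandwich[OF _ _ tendsto_const inv];
            use wut in \<open>auto intro!: always_eventually less_imp_le\<close>)+
      obtain t0 r where r: "t0 \<in> K" "strict_mono r" "(t \<circ> r) \<longlonglongrightarrow> t0"
        using K wut(5) unfolding compact_def by metis
      have tr: "(\<lambda>n. t (r n)) \<longlonglongrightarrow> t0" using r(3) by (simp add: o_def)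
      have wr: "(\<lambda>n. w (r n)) \<longlonglongrightarrow> x" "(\<lambda>n. u (r n)) \<longlonglongrightarrow> x"
        using lim r(2) by (auto dest: LIMSEQ_subseq_LIMSEQ simp: o_def)
      have in_ab: "w n \<in> {a<..<b}" "u n \<in> {a<..<b}" for n using wut(1,2)[of n] ab by auto
      have lim_f: "(\<lambda>n. f (w (r n)) (t (r n))) \<longlonglongrightarrow> f x t0"
        using seq(1)[OF wr(1) tr r(1)] in_ab wut(5) by auto
      \<comment> \<open>Comparison with the competitor \<open>t1\<close> shows that the limit
        \<open>t0\<close> of maximisers is itself a maximiser at \<open>x\<close>.\<close>
      have "(\<lambda>n. f (w (r n)) t1) \<longlonglongrightarrow> f x t1"
        using seq(1)[OF wr(1) tendsto_const t1K(1)] in_ab t1K by auto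
      moreover have "f (w (r n)) t1 \<le> f (w (r n)) (t (r n))" for n
        using le[of "w (r n)" t1] in_ab t1K wut(6) by metis
      ultimately have "f x t1 \<le> f x t0" using lim_f by (intro LIMSEQ_le) auto
      then have "t0 \<in> M" using le[of x t0] r(1) t1K ab by (auto simp: M_def)
      then have "f' x t0 \<le> D" using t1 by (simp add: D_def)
      moreover have "(\<lambda>n. f' (u (r n)) (t (r n))) \<longlonglongrightarrow> f' x t0"
        using seq(2)[OF wr(2) tr r(1)] in_ab wut(5) by auto
      then have "y \<le> f' x t0" using wut(7) by (intro LIMSEQ_le_const) auto
      ultimately show False using \<open>D < y\<close> by linarith
    qed
  qed
  then have "(F has_real_derivative D) (at_right x)" by (simp add: has_field_derivative_iff)
  then show ?thesis using t1(2) by (intro that[of D]) (auto simp: M_def D_def)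
qed

text \<open>The right-hand version is applied to \<open>F (- w)\<close>. Derivatives change sign, so
  the upper bound becomes a lower bound.\<close>

lemma max_function_left_derivative:
  fixes f f' :: "real \<Rightarrow> 'a::metric_space \<Rightarrow> real"
  assumes K: "compact K" and ab: "a < x" "x < b"
    and deriv: "\<And>w t. w \<in> {a<..<b} \<Longrightarrow> t \<in> K \<Longrightarrow> ((\<lambda>w. f w t) has_real_derivative f' w t) (at w)"
    and cont: "continuous_on ({a<..<b} \<times> K) (\<lambda>(w, t). f w t)"
    and cont': "continuous_on ({a<..<b} \<times> K) (\<lambda>(w, t). f' w t)"
    and le: "\<And>w t. w \<in> {a<..<b} \<Longrightarrow> t \<in> K \<Longrightarrow> f w t \<le> F w"
    and attained: "\<And>w. w \<in> {a<..<b} \<Longrightarrow> \<exists>t\<in>K. F w = f w t"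
  obtains D where "(F has_real_derivative D) (at_left x)"
    "\<And>t. t \<in> K \<Longrightarrow> f x t = F x \<Longrightarrow> D \<le> f' x t"
proof -
  have maps: "(\<lambda>p. (- fst p, snd p)) ` ({- b<..<- a} \<times> K) \<subseteq> {a<..<b} \<times> K" by auto
  have cm: "continuous_on ({- b<..<- a} \<times> K) (\<lambda>p. (- fst p, snd p))"
    by (intro continuous_intros)
  obtain D where D: "((\<lambda>w. F (- w)) has_real_derivative D) (at_right (- x))"
    "\<And>t. t \<in> K \<Longrightarrow> f (- (- x)) t = F (- (- x)) \<Longrightarrow> - f' (- (- x)) t \<le> D"
  proof (rule max_function_right_derivative[of K "- b" "- x" "- a" "\<lambda>w. f (- w)" "\<lambda>w t. - f' (- w) t"
        "\<lambda>w. F (- w)"])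
    show "((\<lambda>w. f (- w) t) has_real_derivative - f' (- w) t) (at w)"
      if "w \<in> {- b<..<- a}" "t \<in> K" for w t
      using that by (auto intro!: DERIV_chain'[OF _ deriv, where f = uminus, THEN DERIV_cong] derivative_eq_intros)
    show "continuous_on ({- b<..<- a} \<times> K) (\<lambda>(w, t). f (- w) t)"
      using continuous_on_compose2[OF cont cm maps] by (simp add: case_prod_unfold)
    show "continuous_on ({- b<..<- a} \<times> K) (\<lambda>(w, t). - f' (- w) t)"
      using continuous_on_minus[OF continuous_on_compose2[OF cont' cm maps]] by (simp add: case_prod_unfold)
    show "\<exists>t\<in>K. F (- w) = f (- w) t" if "w \<in> {- b<..<- a}" for w
      using attained[of "- w"] that by auto
  qed (use K ab le in auto)
  show ?thesis
    using has_real_derivative_mirror_at_right[OF D(1)] D(2) by (intro that[of "- D"]) force+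
qed

text \<open>The left derivative lies below and the right derivative above \<open>f' x\<close> at
  every maximiser, so two different values keep them apart.\<close>

lemma derivative_jump_max_function:
  fixes f f' :: "real \<Rightarrow> 'a::metric_space \<Rightarrow> real"
  assumes "compact K" "a < x" "x < b"
    and "\<And>w t. w \<in> {a<..<b} \<Longrightarrow> t \<in> K \<Longrightarrow> ((\<lambda>w. f w t) has_real_derivative f' w t) (at w)"
    and "continuous_on ({a<..<b} \<times> K) (\<lambda>(w, t). f w t)"
    and "continuous_on ({a<..<b} \<times> K) (\<lambda>(w, t). f' w t)"
    and "\<And>w t. w \<in> {a<..<b} \<Longrightarrow> t \<in> K \<Longrightarrow> f w t \<le> F w"
    and "\<And>w. w \<in> {a<..<b} \<Longrightarrow> \<exists>t\<in>K. F w = f w t"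
    and t: "s \<in> K" "f x s = F x" "t \<in> K" "f x t = F x" "f' x s \<noteq> f' x t"
  shows "derivative_jump F x"
proof -
  obtain r where r: "(F has_real_derivative r) (at_right x)"
      "\<And>t. t \<in> K \<Longrightarrow> f x t = F x \<Longrightarrow> f' x t \<le> r"
    by (rule max_function_right_derivative[OF assms(1-8)]) blast+
  obtain l where l: "(F has_real_derivative l) (at_left x)"
      "\<And>t. t \<in> K \<Longrightarrow> f x t = F x \<Longrightarrow> l \<le> f' x t"
    by (rule max_function_left_derivative[OF assms(1-8)]) blast+
  have "l \<noteq> r" using r(2) l(2) t by (metis order_antisym order_trans)
  with r l show ?thesis unfolding derivative_jump_def by blast
qed

section \<open>The jump at the critical point\<close>

definition quad_deriv :: "real \<Rightarrow> real \<Rightarrow> real \<Rightarrow> real \<Rightarrow> real" where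
  "quad_deriv q w x y
     = - ((x + (q - 1) * y)^2 / (q * (q + w)^2) + (q - 1) * (x - y)^2 / (q * w^2))"

definition ratio_deriv :: "nat \<Rightarrow> real \<Rightarrow> real \<Rightarrow> real \<Rightarrow> real \<Rightarrow> real" where
  "ratio_deriv d q w x y = (x ^ d + (q - 1) * y ^ d)
     * (- (real d / 2) * quad q w x y powr (- (real d / 2) - 1) * quad_deriv q w x y)"

lemma ratio_has_derivative:
  assumes "q > 1" "w > 0" "x \<noteq> 0 \<or> y \<noteq> 0"
  shows "((\<lambda>w. ratio d q w x y) has_real_derivative ratio_deriv d q w x y) (at w)"
proof -
  have qd: "((\<lambda>w. quad q w x y) has_real_derivative quad_deriv q w x y) (at w)"
  proof -
    have 1: "((\<lambda>w. a / (q * (q + w))) has_real_derivative - (a / (q * (q + w)^2))) (at w)" for a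
      using assms(1,2)
      by (auto intro!: derivative_eq_intros simp: power2_eq_square divide_simps)
    have 2: "((\<lambda>w. a / (q * w)) has_real_derivative - (a / (q * w^2))) (at w)" for a
      using assms(1,2)
      by (auto intro!: derivative_eq_intros simp: power2_eq_square divide_simps)
    show ?thesis
      unfolding quad_def quad_deriv_def minus_add_distrib by (intro DERIV_add 1 2)
  qed
  show ?thesis
    unfolding ratio_def ratio_deriv_def using quad_pos[OF assms]
    by (auto intro!: derivative_eq_intros DERIV_fun_powr[OF qd, THEN DERIV_cong])
qed

text \<open>Here \<open>z\<close> is a unit vector \<open>(x, Y)\<close> with
  \<open>Y = c * y\<close>. The unit circle is a compact set of directions that avoids the origin
  and is preserved by swapping the coordinates.\<close>

lemma continuous_on_ratio:
  assumes "q > 1" "c \<noteq> 0"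
  shows "continuous_on ({0<..<b} \<times> sphere 0 1) (\<lambda>(w, z). ratio d q w (fst z) (snd z / c))"
    and "continuous_on ({0<..<b} \<times> sphere 0 1) (\<lambda>(w, z). ratio_deriv d q w (fst z) (snd z / c))"
proof -
  let ?S = "{0<..<b} \<times> sphere (0 :: real \<times> real) 1"
  have nz: "quad q (fst p) (fst (snd p)) (snd (snd p) / c) \<noteq> 0" if "p \<in> ?S" for p
  proof -
    have "snd p \<noteq> 0" using that by auto
    then have "fst (snd p) \<noteq> 0 \<or> snd (snd p) \<noteq> 0" by (metis prod_eq_iff fst_zero snd_zero)
    then show ?thesis
      using quad_pos[of q "fst p" "fst (snd p)" "snd (snd p) / c"] assms that by auto
  qed
  have cq: "continuous_on ?S (\<lambda>p. quad q (fst p) (fst (snd p)) (snd (snd p) / c))"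
    "continuous_on ?S (\<lambda>p. quad_deriv q (fst p) (fst (snd p)) (snd (snd p) / c))"
    unfolding quad_def quad_deriv_def using assms
    by (auto intro!: continuous_intros)
  show "continuous_on ?S (\<lambda>(w, z). ratio d q w (fst z) (snd z / c))"
    unfolding ratio_def case_prod_unfold using nz assms by (intro continuous_intros cq) auto
  show "continuous_on ?S (\<lambda>(w, z). ratio_deriv d q w (fst z) (snd z / c))"
    unfolding ratio_deriv_def case_prod_unfold using nz assms by (intro continuous_intros cq) auto
qed

text \<open>The difference \<open>D n\<close> of the two sides satisfies \<open>D (n + 1) \<ge> c * D n\<close> by Bernoulli's inequality.\<close>

lemma power_gap:
  fixes c :: real
  assumes "c > 1" "n \<ge> 1"
  shows "real (n + 2) * (c ^ (n + 1) - c) < real n * (c ^ (n + 2) - 1)"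
  using assms(2)
proof (induction n rule: dec_induct)
  case base
  have "1 * (c ^ (1 + 2) - 1) - real (1 + 2) * (c ^ (1 + 1) - c) = (c - 1) ^ 3"
    by (simp add: power2_eq_square power3_eq_cube algebra_simps)
  moreover have "(c - 1) ^ 3 > 0" using assms by simp
  ultimately show ?case by linarith
next
  case (step n)
  let ?D = "\<lambda>n. real n * (c ^ (n + 2) - 1) - real (n + 2) * (c ^ (n + 1) - c)"
  have "?D (Suc n) = c * ?D n + (c - 1) * (c ^ (n + 2) - (1 + real (n + 2) * (c - 1)))"
    by (simp add: algebra_simps)
  moreover have "c ^ (n + 2) \<ge> 1 + real (n + 2) * (c - 1)"
    using Bernoulli_inequality[of "c - 1" "n + 2"] assms by simp
  then have "(c - 1) * (c ^ (n + 2) - (1 + real (n + 2) * (c - 1))) \<ge> 0"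
    using assms by simp
  moreover have "c * ?D n > 0" using step.IH assms by simp
  ultimately show ?case by linarith
qed

text \<open>In the next three lemmas \<open>crit\<close> is the equation \<open>w = w_crit d q\<close> for \<open>c = (q - 1) powr (1 / d)\<close>.\<close>

lemma quad_critical:
  assumes "q > 1" "w > 0" "c > 0" and crit: "c^2 * (w + (q - 1)) = (q - 1) * (1 + w)"
  shows "quad q w x (y / c)
    = ((w + (q - 1)) * (x^2 + y^2) - 2 * ((q - 1) / c) * (x * y)) / (w * (q + w))"
proof -
  have "(q - 1) * (1 + w) * (y / c)^2 = (w + (q - 1)) * y^2"
    unfolding crit[symmetric] using assms(3) by (simp add: power_divide)
  moreover have "2 * (q - 1) * (x * (y / c)) = 2 * ((q - 1) / c) * (x * y)"
    by (simp only: times_divide_eq_right times_divide_eq_left mult.assoc)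
  ultimately show ?thesis
    unfolding quad_expand[OF assms(1,2)] distrib_left[of "w + (q - 1)"] by (simp only: diff_add_eq)
qed

text \<open>The mixed terms agree on both sides, so their difference is a multiple of
  \<open>x^2 - y^2\<close>. The factor is nonzero because \<open>quad\<close> and
  \<open>quad_deriv\<close> cannot both be symmetric in these coordinates.\<close>

lemma quad_deriv_swap_eq:
  assumes "q > 2" "w > 0" "c > 0" and crit: "c^2 * (w + (q - 1)) = (q - 1) * (1 + w)"
    and eq: "quad_deriv q w x (y / c) = quad_deriv q w y (x / c)"
  shows "x^2 = y^2"
proof -
  define m where "m = q - 1"
  define u v where "u = 1 / (q + w)" and "v = 1 / w"
  define g where "g = u^2 + m * v^2 - (m^2 * u^2 + m * v^2) / c^2"
  have m: "m > 1" "q = m + 1" using assms(1) by (simp_all add: m_def)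
  have uv: "0 < u" "u < v"
    using assms(1,2) by (auto simp: u_def v_def frac_less2)
  have qd: "quad_deriv q w a b = - (u^2 * (a + m * b)^2 + m * v^2 * (a - b)^2) / q" for a b
    unfolding quad_deriv_def u_def v_def m_def[symmetric]
    by (simp add: power_divide add_divide_distrib diff_divide_distrib mult.commute[of q "(q + w)^2"] mult.commute[of q "w^2"])
  have "u^2 * (x + m * (y / c))^2 + m * v^2 * (x - y / c)^2
      = u^2 * (y + m * (x / c))^2 + m * v^2 * (y - x / c)^2"
    using eq assms(1) unfolding qd by simp
  moreover have "u^2 * (x + m * (y / c))^2 + m * v^2 * (x - y / c)^2
      - (u^2 * (y + m * (x / c))^2 + m * v^2 * (y - x / c)^2) = g * (x^2 - y^2)"
    unfolding g_def by (simp add: power2_eq_square algebra_simps add_divide_distrib diff_divide_distrib)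
  ultimately have "g * (x^2 - y^2) = 0" by linarith
  moreover have "g \<noteq> 0"
  proof
    assume "g = 0"
    then have g: "c^2 * (u^2 + m * v^2) = m * (m * u^2 + v^2)"
      using assms(3) by (simp add: g_def field_simps power2_eq_square)
    have "u * (q + w) = 1" "v * w = 1"
      using assms(1,2) by (simp_all add: u_def v_def)
    then have uvw: "u + m * v = q * (w + m) * (u * v)" "m * u + v = q * (1 + w) * (u * v)"
      unfolding m(2) by algebra+
    \<comment> \<open>This is \<open>crit\<close>, and \<open>g\<close> is the same equation with
      \<open>u\<close> and \<open>v\<close> squared. Eliminating \<open>c^2\<close> leaves a product
      of nonzero factors.\<close>
    have "c^2 * (u + m * v) = m * (m * u + v)"
      using crit unfolding uvw m_def[symmetric] by algebra
    with g have "c^2 * (m * ((u + m * v) * (m * u^2 + v^2) - (m * u + v) * (u^2 + m * v^2))) = 0"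
      by algebra
    moreover have "(u + m * v) * (m * u^2 + v^2) - (m * u + v) * (u^2 + m * v^2)
        = u * v * ((m^2 - 1) * (u - v))"
      by algebra
    moreover have "m^2 > 1" using m(1) by simp
    ultimately show False using uv m assms(3) by auto
  qed
  ultimately show ?thesis by simp
qed

text \<open>In the coordinates \<open>(x, Y)\<close>, the value at \<open>(1, 1)\<close> bounds all
  values with \<open>x^2 = Y^2\<close>, and the perturbation \<open>(1 + e, 1 - e)\<close> beats
  it.\<close>

lemma maximiser_not_on_diagonal:
  assumes d: "d \<ge> 3" and q: "q > 2" and w: "w > 0" and c: "c > 1" "c ^ d = q - 1" "c^2 < q - 1"
    and crit: "c^2 * (w + (q - 1)) = (q - 1) * (1 + w)"
    and xy: "x \<noteq> 0 \<or> y \<noteq> 0" and max: "Phi d q w = ratio d q w x (y / c)"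
  shows "x^2 \<noteq> y^2"
proof
  assume "x^2 = y^2"
  then have abs: "\<bar>x\<bar> = \<bar>y\<bar>" by (metis real_sqrt_abs)
  with xy have s: "\<bar>x\<bar> > 0" by auto
  define m where "m = q - 1"
  define A B where "A = (w + m) / (w * (q + w))" and "B = m / c / (w * (q + w))"
  have den: "w * (q + w) > 0" using w q by simp
  have B: "B > 0" using den c q by (simp add: B_def m_def)
  have Q: "quad q w a (b / c) = A * (a^2 + b^2) - 2 * B * (a * b)" for a b
  proof -
    have "quad q w a (b / c) = ((w + m) * (a^2 + b^2) - 2 * (m / c) * (a * b)) / (w * (q + w))"
      using quad_critical[of q w c a b] q w c(1) crit unfolding m_def by linarith
    then show ?thesis by (simp add: A_def B_def diff_divide_distrib)
  qed
  \<comment> \<open>Equivalent to \<open>k < d - 1\<close> for the eigenvalue ratio \<open>k\<close>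
    below; \<open>power_gap\<close> with exponent \<open>d - 2\<close> supplies it.\<close>
  have AB: "real d * B < (real d - 2) * A"
  proof -
    obtain n where n: "d = n + 2" "n \<ge> 1"
      using d by (intro that[of "d - 2"]) auto
    have "real d * (c ^ (n + 1) - c) < real n * (m - 1)"
      using power_gap[OF c(1) n(2)] c(2) n(1) by (simp add: m_def)
    then have "c * (real d * (c ^ (n + 1) - c)) < c * (real n * (m - 1))" using c(1) by simp
    moreover have "c * (real d * (c ^ (n + 1) - c)) = real d * (m - c^2)"
      unfolding m_def c(2)[symmetric] n(1) by (simp add: algebra_simps power2_eq_square)
    ultimately have "real d * (m - c^2) < c * (real n * (m - 1))" by linarith
    then have "real d * (m - c^2) * m < c * (real n * (m - 1)) * m"
      using q by (intro mult_strict_right_mono) (auto simp: m_def)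
    \<comment> \<open>\<open>crit\<close> exposes the positive factor \<open>m - c^2\<close> on the
      right as well, so that it cancels.\<close>
    also have "(m - 1) * m = (w + m) * (m - c^2)"
      using crit unfolding m_def[symmetric] by algebra
    then have "c * (real n * (m - 1)) * m = c * real n * (w + m) * (m - c^2)"
      by (simp add: mult.assoc)
    finally have "real d * m * (m - c^2) < c * real n * (w + m) * (m - c^2)"
      by (simp add: mult_ac)
    then have "real d * m < c * real n * (w + m)"
      using c(3) by (simp add: m_def)
    then have "real d * (m / c) < real n * (w + m)"
      using c(1) by (simp add: divide_simps mult_ac)
    then have "real d * (m / c) / (w * (q + w)) < real n * (w + m) / (w * (q + w))"
      using den by (intro divide_strict_right_mono)
    then show ?thesis using n(1) by (simp add: A_def B_def)
  qed
  have AgtB: "A > B"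
  proof -
    have "(real d - 2) * B \<le> real d * B" using B by (intro mult_right_mono) auto
    with AB have "(real d - 2) * B < (real d - 2) * A" by linarith
    then show ?thesis using d mult_less_cancel_left_pos[of "real d - 2" B A] by simp
  qed
  \<comment> \<open>\<open>A + B\<close> and \<open>A - B\<close> are the eigenvalues of the
    symmetric form on the antidiagonal and on the diagonal.\<close>
  define k where "k = (A + B) / (A - B)"
  have "A + B < (real d - 1) * (A - B)" using AB by (simp add: algebra_simps)
  then have "k < real d - 1" unfolding k_def using AgtB by (subst pos_divide_less_eq) auto
  then obtain e where e: "0 < e" "e < 1"
    "(1 + e) ^ d + (1 - e) ^ d > 2 * (1 + k * e^2) powr (real d / 2)"
    using two_point_power_gt[of d k] d by auto
  have num: "a ^ d + (q - 1) * (b / c) ^ d = a ^ d + b ^ d" for a b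
    unfolding c(2)[symmetric] using c(1) by (simp add: power_divide)
  have kp: "1 + k * e^2 > 0" using AgtB B by (simp add: k_def add_pos_nonneg)
  have Qe: "quad q w (1 + e) ((1 - e) / c) = 2 * (A - B) * (1 + k * e^2)"
  proof -
    have "(A - B) * (1 + k * e^2) = (A - B) + (A + B) * e^2"
      using AgtB by (simp add: k_def distrib_left)
    then show ?thesis unfolding Q by (simp add: power2_eq_square algebra_simps)
  qed
  let ?h = "real d / 2"
  \<comment> \<open>Replacing both coordinates by \<open>\<bar>x\<bar>\<close> neither raises
    \<open>quad\<close> nor lowers the numerator, which covers all sign combinations.\<close>
  have Qxy: "quad q w x (y / c) \<ge> 2 * (A - B) * \<bar>x\<bar>^2"
  proof -
    have "x * y \<le> \<bar>x\<bar> * \<bar>y\<bar>" using abs_ge_self[of "x * y"] by (simp only: abs_mult)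
    then have "2 * B * (x * y) \<le> 2 * B * \<bar>x\<bar>^2"
      using B abs by (simp add: power2_eq_square)
    with \<open>x^2 = y^2\<close> show ?thesis unfolding Q by (simp add: algebra_simps)
  qed
  have "ratio d q w x (y / c) \<le> (2 * \<bar>x\<bar> ^ d) * quad q w x (y / c) powr (- ?h)"
  proof -
    have "x ^ d \<le> \<bar>x\<bar> ^ d" "y ^ d \<le> \<bar>y\<bar> ^ d"
      using abs_ge_self[of "x ^ d"] abs_ge_self[of "y ^ d"] by (simp_all only: power_abs)
    then show ?thesis
      unfolding ratio_def num using abs by (intro mult_right_mono) auto
  qed
  also have "\<dots> \<le> (2 * \<bar>x\<bar> ^ d) * (2 * (A - B) * \<bar>x\<bar>^2) powr (- ?h)"
    using Qxy s AgtB by (intro mult_left_mono powr_mono2') auto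
  also have "\<dots> = 2 * (2 * (A - B)) powr (- ?h)"
  proof -
    have "(\<bar>x\<bar>^2) powr ?h = \<bar>x\<bar> ^ d" using d by (intro powr_half_power) auto
    then show ?thesis
      unfolding powr_mult powr_minus[of "\<bar>x\<bar>^2"] using s by simp
  qed
  also have "\<dots> = 2 * (1 + k * e^2) powr ?h * quad q w (1 + e) ((1 - e) / c) powr (- ?h)"
    unfolding Qe powr_mult powr_minus using kp by simp
  also have "\<dots> < ratio d q w (1 + e) ((1 - e) / c)"
    unfolding ratio_def num using e kp AgtB by (intro mult_strict_right_mono) (auto simp: Qe)
  also have "\<dots> \<le> Phi d q w" using d q w e c(1) by (intro ratio_le_Phi) auto
  finally show False using max by simp
qed

lemma derivative_jump_Phi:
  assumes d: "d \<ge> 3" and q: "q > 2"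
  shows "derivative_jump (Phi d q) (w_crit d q)"
proof -
  define c where "c = (q - 1) powr (1 / real d)"
  have c: "c > 0" "c ^ d = q - 1"
    unfolding c_def using q d by (simp_all add: powr_power)
  note wc = w_crit_eq[OF d q c]
  define w where "w = w_crit d q"
  have w: "w > 0" using wc(4) by (simp add: w_def)
  have "w * (q - 1 - c^2) = (q - 1) * (c^2 - 1)"
    unfolding w_def wc(3) using wc(2) by simp
  then have crit: "c^2 * (w + (q - 1)) = (q - 1) * (1 + w)" by algebra
  define f where "f v z = ratio d q v (fst z) (snd z / c)" for v z
  define f' where "f' v z = ratio_deriv d q v (fst z) (snd z / c)" for v z
  have nz: "fst z \<noteq> 0 \<or> snd z / c \<noteq> 0" if "z \<in> sphere 0 1" for z :: "real \<times> real"
    using that c(1) by (cases z) (auto simp: zero_prod_def)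
  have le: "f v z \<le> Phi d q v" if "v > 0" "z \<in> sphere 0 1" for v z
    unfolding f_def using d q that nz by (intro ratio_le_Phi) auto
  have attained: "\<exists>z\<in>sphere 0 1. Phi d q v = f v z" if v: "v > 0" for v
  proof -
    obtain x y where xy: "x \<noteq> 0 \<or> y \<noteq> 0" "Phi d q v = ratio d q v x y"
      using Phi_eq_ratio[of q v] q v by auto
    define s where "s = inverse (norm (x, c * y))"
    have n: "norm (x, c * y) > 0" using xy(1) c(1) by (auto simp: zero_prod_def)
    then have s: "s > 0" by (simp add: s_def)
    have "norm (s *\<^sub>R (x, c * y)) = 1"
      unfolding norm_scaleR using n by (simp add: s_def del: norm_Pair)
    then have "s *\<^sub>R (x, c * y) \<in> sphere 0 1" by (simp only: mem_sphere_0)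
    moreover have "f v (s *\<^sub>R (x, c * y)) = ratio d q v (s * x) (s * y)"
      using c(1) by (simp add: f_def)
    ultimately show ?thesis using ratio_scale[OF s, of d q v x y] d xy(2) by (metis zero_less_iff_neq_zero not_numeral_le_zero)
  qed
  obtain z where z: "z \<in> sphere 0 1" "Phi d q w = f w z" using attained[OF w] by blast
  obtain x y where xy: "z = (x, y)" by (cases z)
  have xy0: "x \<noteq> 0 \<or> y \<noteq> 0" using z(1) xy by (auto simp: zero_prod_def)
  have swap: "(y, x) \<in> sphere (0 :: real \<times> real) 1"
    using z(1) by (simp add: xy norm_Pair add.commute)
  have num: "a ^ d + (q - 1) * (b / c) ^ d = a ^ d + b ^ d" for a b
    unfolding c(2)[symmetric] using c(1) by (simp add: power_divide)
  have Qswap: "quad q w y (x / c) = quad q w x (y / c)"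
    using q w c(1) crit by (simp add: quad_critical add.commute mult.commute)
  have fswap: "f w (y, x) = f w (x, y)"
    unfolding f_def ratio_def by (simp add: num Qswap add.commute)
  have ne: "x^2 \<noteq> y^2"
    using maximiser_not_on_diagonal[OF d q w wc(1) c(2) wc(2) crit xy0] z(2) by (simp add: f_def xy)
  \<comment> \<open>Positivity makes the numerator nonzero at a maximiser, so the factor
    \<open>E\<close> common to both derivatives can be cancelled.\<close>
  have Phi_pos: "Phi d q w > 0"
  proof -
    have "0 < ratio d q w 1 1"
      using quad_pos[of q w 1 1] q w by (simp add: ratio_def)
    also have "\<dots> \<le> Phi d q w" using d q w by (intro ratio_le_Phi) auto
    finally show ?thesis .
  qed
  have "f' w (x, y) \<noteq> f' w (y, x)"
  proof
    assume eq: "f' w (x, y) = f' w (y, x)"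
    define E where "E = (x ^ d + y ^ d) * (- (real d / 2) * quad q w x (y / c) powr (- (real d / 2) - 1))"
    have "f' w (x, y) = E * quad_deriv q w x (y / c)" "f' w (y, x) = E * quad_deriv q w y (x / c)"
      unfolding f'_def ratio_deriv_def E_def by (simp_all add: num Qswap add.commute)
    moreover have "E \<noteq> 0"
    proof -
      have "x ^ d + y ^ d \<noteq> 0" using Phi_pos z(2) by (auto simp: xy f_def ratio_def num)
      moreover have "quad q w x (y / c) > 0" using q w xy0 c(1) by (intro quad_pos) auto
      ultimately show ?thesis using d by (simp add: E_def)
    qed
    ultimately have "quad_deriv q w x (y / c) = quad_deriv q w y (x / c)" using eq by simp
    with quad_deriv_swap_eq[OF q w c(1) crit] ne show False by blast
  qed
  moreover have "continuous_on ({0<..<w + 1} \<times> sphere 0 1) (\<lambda>(w, z). f w z)"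
    "continuous_on ({0<..<w + 1} \<times> sphere 0 1) (\<lambda>(w, z). f' w z)"
    unfolding f_def f'_def using q c(1) by (intro continuous_on_ratio; simp)+
  moreover have "((\<lambda>v. f v z) has_real_derivative f' v z) (at v)"
    if "v \<in> {0<..<w + 1}" "z \<in> sphere 0 1" for v z
    unfolding f_def f'_def using that q nz by (intro ratio_has_derivative) auto
  ultimately show ?thesis
    unfolding w_def[symmetric]
    using z w swap fswap le attained
    by (intro derivative_jump_max_function[of "sphere 0 1" 0 w "w + 1" f f' "Phi d q" "(x, y)" "(y, x)"])
       (auto simp: xy)
qed

theorem proposition3p53:
  fixes d :: nat and q :: real
  assumes "d \<ge> 3" and "q \<ge> 2"
  shows "(\<forall>w > w_crit d q. Phi d q w > q * (1 + w / q) powr (real d / 2)) \<and>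
         (q > 2 \<longrightarrow> derivative_jump (Phi d q) (w_crit d q))"
proof (cases "q = 2")
  case True
  then show ?thesis using Phi_gt_q2[OF assms(1)] by (simp add: w_crit_def)
next
  case False
  with assms(2) have "q > 2" by simp
  with assms(1) show ?thesis using Phi_gt derivative_jump_Phi by blast
qed

end
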